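(* Let $X_G$ be the two-dimensional shift of finite type generated by a two-dimensional graph $G=(H,V)$, with associated sets $A_1,A_2$ of triangular patterns and associated matrices $M$ (indexed by $A_1$) and $N$ (indexed by $A_2$). Suppose that the sequence spaces generated by $M$ and by $N$ are non-empty. If for all $i,j\in A_1$ with $M_{ij}\neq 0$ and every E-pair $i_1\in A_2$ of $i$ there exists an E-pair $j_1\in A_2$ of $j$ such that $N_{i_1j_1}\neq 0$, then $X_G\neq\emptyset$.
   Context: A two-dimensional graph is a pair $G=(H,V)$ of directed graphs (at most one edge for each ordered pair of vertices, loops allowed) on a common finite vertex set $\mathcal{V}$; $H$ and $V$ also denote their $0$-$1$ adjacency matrices. The shift space generated by $G$ is $$X_G=\{x\in\mathcal{V}^{\mathbb{Z}^2}: H_{x(i,j),x(i+1,j)}=1 \text{ and } V_{x(i,j),x(i,j+1)}=1 \text{ for all } (i,j)\in\mathbb{Z}^2\}.$$ A $2\times 2$ pattern with bottom row $p\,q$ and top row $r\,s$ (left to right) is allowed if $H_{pq}=H_{rs}=V_{pr}=V_{qs}=1$. $A_1$ is the set of triples $(a,b,c)\in\mathcal{V}^3$, regarded as triangular patterns with $a$ bottom-left, $b$ bottom-right, $c$ top-right, for which there is $d\in\mathcal{V}$ such that the $2\times2$ pattern with bottom row $a\,b$ and top row $d\,c$ is allowed. $A_2$ is the set of triples $(x,y,z)\in\mathcal{V}^3$, regarded as triangular patterns with $x$ bottom-left, $y$ top-left, $z$ top-right, for which there is $w\in\mathcal{V}$ such that the $2\times 2$ pattern with bottom row $x\,w$ and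 top row $y\,z$ is allowed. $M$ is the $0$-$1$ matrix indexed by $A_1$ with $M_{IJ}=1$ if and only if $I=(a_1,a_2,a_3)$, $J=(a_3,a_4,a_5)$ (the last entry of $I$ equals the first entry of $J$) and $(a_2,a_3,a_4)\in A_2$. $N$ is the $0$-$1$ matrix indexed by $A_2$ with $N_{RS}=1$ if and only if $R=(b_1,b_2,b_3)$, $S=(b_3,b_4,b_5)$ (the last entry of $R$ equals the first entry of $S$) and $(b_2,b_3,b_4)\in A_1$. The sequence space generated by a $0$-$1$ matrix $B$ with index set $\mathcal{I}$ is the set of all bi-infinite sequences $(t_n)_{n\in\mathbb{Z}}\in\mathcal{I}^{\mathbb{Z}}$ with $B_{t_nt_{n+1}}=1$ for all $n$. An element $I=(a_1,a_2,a_3)\in A_1$ and an element $J=(x,y,z)\in A_2$ form an E-pair (each is called an E-pair of the other) if $x=a_1$ and $z=a_3$, i.e. if they have the same bottom-left and the same top-right symbols. *)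

theory Defs
  imports "Graph_Theory.Pair_Digraph"
begin

(* A pair digraph has at most one arc for each ordered pair of vertices and may have loops. *)

type_synonym 'v two_dim_graph = "'v pair_pre_digraph \<times> 'v pair_pre_digraph"

abbreviation hor :: "'v two_dim_graph \<Rightarrow> 'v pair_pre_digraph" where
  "hor G \<equiv> fst G"

abbreviation ver :: "'v two_dim_graph \<Rightarrow> 'v pair_pre_digraph" where
  "ver G \<equiv> snd G"

definition two_dim_graph :: "'v two_dim_graph \<Rightarrow> bool" where
  "two_dim_graph G \<longleftrightarrow>
     pair_fin_digraph (hor G) \<and> pair_fin_digraph (ver G) \<and> pverts (hor G) = pverts (ver G)"

abbreviation symbols :: "'v two_dim_graph \<Rightarrow> 'v set" where
  "symbols G \<equiv> pverts (hor G)"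

definition adj :: "'v pair_pre_digraph \<Rightarrow> 'v \<Rightarrow> 'v \<Rightarrow> nat" where
  "adj D p q = of_bool ((p, q) \<in> parcs D)"

definition shift_space :: "'v two_dim_graph \<Rightarrow> (int \<times> int \<Rightarrow> 'v) set" where
  "shift_space G =
     {x. range x \<subseteq> symbols G \<and>
         (\<forall>i j. adj (hor G) (x (i, j)) (x (i + 1, j)) = 1 \<and>
                adj (ver G) (x (i, j)) (x (i, j + 1)) = 1)}"

(* Bottom row p q, top row r s. *)
definition allowed :: "'v two_dim_graph \<Rightarrow> 'v \<Rightarrow> 'v \<Rightarrow> 'v \<Rightarrow> 'v \<Rightarrow> bool" where
  "allowed G p q r s \<longleftrightarrow>
     adj (hor G) p q = 1 \<and> adj (hor G) r s = 1 \<and>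
     adj (ver G) p r = 1 \<and> adj (ver G) q s = 1"

(* Bottom-left, bottom-right, top-right. *)
definition A1 :: "'v two_dim_graph \<Rightarrow> ('v \<times> 'v \<times> 'v) set" where
  "A1 G = {(a, b, c). a \<in> symbols G \<and> b \<in> symbols G \<and> c \<in> symbols G \<and>
                      (\<exists>d\<in>symbols G. allowed G a b d c)}"

(* Bottom-left, top-left, top-right. *)
definition A2 :: "'v two_dim_graph \<Rightarrow> ('v \<times> 'v \<times> 'v) set" where
  "A2 G = {(x, y, z). x \<in> symbols G \<and> y \<in> symbols G \<and> z \<in> symbols G \<and>
                      (\<exists>w\<in>symbols G. allowed G x w y z)}"

(* The matrices below are total functions; only their entries with both indices in A1 G
   (for matM) or A2 G (for matN) are meaningful. *)

definition matM :: "'v two_dim_graph \<Rightarrow> 'v \<times> 'v \<times> 'v \<Rightarrow> 'v \<times> 'v \<times> 'v \<Rightarrow> nat" where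
  "matM G I J = of_bool (\<exists>a1 a2 a3 a4 a5.
     I = (a1, a2, a3) \<and> J = (a3, a4, a5) \<and> (a2, a3, a4) \<in> A2 G)"

definition matN :: "'v two_dim_graph \<Rightarrow> 'v \<times> 'v \<times> 'v \<Rightarrow> 'v \<times> 'v \<times> 'v \<Rightarrow> nat" where
  "matN G R S = of_bool (\<exists>b1 b2 b3 b4 b5.
     R = (b1, b2, b3) \<and> S = (b3, b4, b5) \<and> (b2, b3, b4) \<in> A1 G)"

definition sequence_space :: "'i set \<Rightarrow> ('i \<Rightarrow> 'i \<Rightarrow> nat) \<Rightarrow> (int \<Rightarrow> 'i) set" where
  "sequence_space A B = {t. range t \<subseteq> A \<and> (\<forall>n. B (t n) (t (n + 1)) = 1)}"

definition E_pair :: "'v two_dim_graph \<Rightarrow> 'v \<times> 'v \<times> 'v \<Rightarrow> 'v \<times> 'v \<times> 'v \<Rightarrow> bool" where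
  "E_pair G I J \<longleftrightarrow> I \<in> A1 G \<and> J \<in> A2 G \<and>
     (\<exists>a1 a2 a3 x y z. I = (a1, a2, a3) \<and> J = (x, y, z) \<and> x = a1 \<and> z = a3)"

end

theory Submission
  imports Defs "HOL-Library.Diagonal_Subsequence" "HOL-Library.Countable"
begin

text \<open>
  A sequence of lower triangles linked by \<^term>\<open>matM G\<close> is a staircase running along a diagonal of
  the plane: its corners \<open>a\<^sub>n\<close> sit at \<open>(n, n)\<close> and \<open>(n + 1, n)\<close> carries the middle entry of
  the \<open>n\<close>-th triangle.  The pairing hypothesis lets one choose, triangle by triangle from a starting
  point onwards, upper triangles over the same corners that are linked by \<^term>\<open>matN G\<close>.  Their
  middle entries are the symbols one diagonal further up, and the links of that second sequence are
  lower triangles forming again a staircase linked by \<^term>\<open>matM G\<close>.  So the construction can be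
  repeated for ever (\<open>next_staircase\<close>).

  Since the choice needs a first triangle, one gets infinite staircases in only one direction, and
  their union fills the octant \<open>0 \<le> i \<le> j\<close> rather than the plane (\<open>octant_filling\<close>).  The octant
  contains arbitrarily large squares, however, and the alphabet is finite, so translates of
  the filling converge pointwise along a subsequence (\<open>pointwise_stabilizing_subsequence\<close>).  Adjacency
  constraints involve only two cells each, so the limit satisfies all of them.
\<close>

definition staircase :: "'v two_dim_graph \<Rightarrow> (nat \<Rightarrow> 'v \<times> 'v \<times> 'v) \<Rightarrow> bool" where
  "staircase G t \<longleftrightarrow> (\<forall>n. t n \<in> A1 G \<and> matM G (t n) (t (Suc n)) \<noteq> 0)"

lemma matM_nonzero_iff:
  "matM G (a, b, c) (a', b', c') \<noteq> 0 \<longleftrightarrow> c = a' \<and> (b, c, b') \<in> A2 G"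
  by (auto simp: matM_def)

lemma matN_nonzero_iff:
  "matN G (x, y, z) (x', y', z') \<noteq> 0 \<longleftrightarrow> z = x' \<and> (y, z, y') \<in> A1 G"
  by (auto simp: matN_def)

lemma A1_D:
  assumes "(a, b, c) \<in> A1 G"
  shows "a \<in> symbols G" and "adj (hor G) a b = 1"
  using assms by (auto simp: A1_def allowed_def)

lemma A2_D:
  assumes "(x, y, z) \<in> A2 G"
  shows "adj (ver G) x y = 1"
  using assms by (auto simp: A2_def allowed_def)

text \<open>The fourth symbol of a square witnessing the lower triangle completes its upper one.\<close>

lemma ex_E_pair:
  assumes "I \<in> A1 G"
  shows "\<exists>J\<in>A2 G. E_pair G I J"
proof -
  obtain a b c where I: "I = (a, b, c)" by (cases I)
  with assms obtain d where "d \<in> symbols G" "allowed G a b d c"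
    by (auto simp: A1_def)
  with assms I have "(a, d, c) \<in> A2 G"
    by (auto simp: A1_def A2_def)
  with assms I show ?thesis
    by (auto simp: E_pair_def intro!: bexI[of _ "(a, d, c)"])
qed

text \<open>
  If the upper triangles \<open>(a\<^sub>n, y\<^sub>n, a\<^sub>n\<^sub>+\<^sub>1)\<close> are linked by \<^term>\<open>matN G\<close>, then the links
  \<open>(y\<^sub>n, a\<^sub>n\<^sub>+\<^sub>1, y\<^sub>n\<^sub>+\<^sub>1)\<close> are the lower triangles of the diagonal above; they
  are linked in turn because \<open>(a\<^sub>n\<^sub>+\<^sub>1, y\<^sub>n\<^sub>+\<^sub>1, a\<^sub>n\<^sub>+\<^sub>2)\<close> is the next upper triangle.
\<close>

lemma next_staircase:
  assumes pairing: "\<forall>i\<in>A1 G. \<forall>j\<in>A1 G. matM G i j \<noteq> 0 \<longrightarrow>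
           (\<forall>i1\<in>A2 G. E_pair G i i1 \<longrightarrow>
             (\<exists>j1\<in>A2 G. E_pair G j j1 \<and> matN G i1 j1 \<noteq> 0))"
    and t: "staircase G t"
  shows "\<exists>u. staircase G u \<and>
           (\<forall>n. fst (snd (u n)) = fst (t (Suc n)) \<and> adj (ver G) (fst (t n)) (fst (u n)) = 1)"
proof -
  have "\<exists>w. \<forall>n. E_pair G (t n) (w n) \<and> matN G (w n) (w (Suc n)) \<noteq> 0"
  proof (rule dependent_nat_choice)
    show "\<exists>J. E_pair G (t 0) J"
      using t ex_E_pair unfolding staircase_def by blast
  next
    fix J n assume J: "E_pair G (t n) J"
    then have "J \<in> A2 G" by (simp add: E_pair_def)
    with J t pairing show "\<exists>J'. E_pair G (t (Suc n)) J' \<and> matN G J J' \<noteq> 0"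
      unfolding staircase_def by blast
  qed
  then obtain w where pair: "\<And>n. E_pair G (t n) (w n)"
    and link: "\<And>n. matN G (w n) (w (Suc n)) \<noteq> 0" by blast
  define a where "a n = fst (t n)" for n
  define y where "y n = fst (snd (w n))" for n
  have w: "w n = (a n, y n, a (Suc n))" for n
  proof -
    have "matM G (t n) (t (Suc n)) \<noteq> 0"
      using t by (simp add: staircase_def)
    then have "fst (t (Suc n)) = snd (snd (t n))"
      by (auto simp: matM_def)
    with pair[of n] show ?thesis
      by (auto simp: E_pair_def a_def y_def)
  qed
  have upper: "(a n, y n, a (Suc n)) \<in> A2 G" for n
    using pair[of n] w[of n] by (simp add: E_pair_def)
  have lower: "(y n, a (Suc n), y (Suc n)) \<in> A1 G" for n
    using link[of n] unfolding w matN_nonzero_iff by simp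
  define u where "u n = (y n, a (Suc n), y (Suc n))" for n
  have "staircase G u"
    using lower upper unfolding staircase_def u_def matM_nonzero_iff by blast
  moreover have "fst (snd (u n)) = fst (t (Suc n)) \<and> adj (ver G) (fst (t n)) (fst (u n)) = 1" for n
    using A2_D[OF upper[of n]] by (simp add: u_def a_def)
  ultimately show ?thesis by blast
qed

text \<open>
  Here \<open>c k n\<close> is the symbol of the cell \<open>(n, n + k)\<close>, so \<open>k\<close> numbers the diagonals.  Moving up
  raises \<open>k\<close>, while moving right lowers \<open>k\<close> and raises \<open>n\<close>.
\<close>

lemma octant_filling:
  assumes pairing: "\<forall>i\<in>A1 G. \<forall>j\<in>A1 G. matM G i j \<noteq> 0 \<longrightarrow>
           (\<forall>i1\<in>A2 G. E_pair G i i1 \<longrightarrow>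
             (\<exists>j1\<in>A2 G. E_pair G j j1 \<and> matN G i1 j1 \<noteq> 0))"
    and t: "staircase G t"
  shows "\<exists>c :: nat \<Rightarrow> nat \<Rightarrow> 'v. \<forall>k n. c k n \<in> symbols (G :: 'v two_dim_graph) \<and>
           adj (ver G) (c k n) (c (Suc k) n) = 1 \<and>
           adj (hor G) (c (Suc k) n) (c k (Suc n)) = 1"
proof -
  have "\<exists>s. \<forall>k. staircase G (s k) \<and>
          (\<forall>n. fst (snd (s (Suc k) n)) = fst (s k (Suc n)) \<and>
               adj (ver G) (fst (s k n)) (fst (s (Suc k) n)) = 1)"
    using t next_staircase[OF pairing] by (intro dependent_nat_choice) blast+
  then obtain s where s: "\<And>k. staircase G (s k)"
    and right: "\<And>k n. fst (snd (s (Suc k) n)) = fst (s k (Suc n))"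
    and up: "\<And>k n. adj (ver G) (fst (s k n)) (fst (s (Suc k) n)) = 1" by blast
  have A1: "(fst (s k n), fst (snd (s k n)), snd (snd (s k n))) \<in> A1 G" for k n
    using s[of k] by (simp add: staircase_def)
  have "adj (hor G) (fst (s (Suc k) n)) (fst (s k (Suc n))) = 1" for k n
    using A1_D(2)[OF A1[of "Suc k" n]] by (simp add: right)
  with up A1_D(1)[OF A1] show ?thesis
    by (intro exI[of _ "\<lambda>k n. fst (s k n)"]) blast
qed

text \<open>
  This is sequential compactness of a countable power of a finite discrete space: at each point some
  value is taken infinitely often, and a diagonal subsequence handles all points at once.
\<close>

lemma pointwise_stabilizing_subsequence:
  fixes f :: "nat \<Rightarrow> 'p::countable \<Rightarrow> 'v"
  assumes "finite A" and "\<And>m p. f m p \<in> A"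
  shows "\<exists>r g. strict_mono (r :: nat \<Rightarrow> nat) \<and> (\<forall>p. \<forall>\<^sub>F m in sequentially. f (r m) p = g p)"
proof -
  define P where "P k s \<longleftrightarrow> (\<exists>v. \<forall>\<^sub>F m in sequentially. f (s m) (from_nat k :: 'p) = v)"
    for k :: nat and s :: "nat \<Rightarrow> nat"
  have "\<exists>r'. strict_mono r' \<and> P k (s \<circ> r')" for k and s :: "nat \<Rightarrow> nat"
  proof -
    let ?h = "\<lambda>m. f (s m) (from_nat k)"
    have "finite (range ?h)"
      using assms by (auto intro: finite_subset[of _ A])
    then obtain m0 where inf: "infinite {m. ?h m = ?h m0}"
      using pigeonhole_infinite[of "UNIV :: nat set" ?h] by auto
    let ?r = "enumerate {m. ?h m = ?h m0}"
    have "strict_mono ?r" using inf by (rule strict_mono_enumerate)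
    moreover have "?h (?r m) = ?h m0" for m
      using enumerate_in_set[OF inf, of m] by simp
    then have "P k (s \<circ> ?r)" by (auto simp: P_def)
    ultimately show ?thesis by blast
  qed
  then interpret subseqs P by unfold_locales
  have "P k (diagseq \<circ> (+) (Suc k))" for k
  proof (rule diagseq_holds)
    fix n r s assume r: "strict_mono (r :: nat \<Rightarrow> nat)" and "P n s"
    then show "P n (s \<circ> r)"
      unfolding P_def using eventually_subseq[OF r] by fastforce
  qed
  then have stable: "\<exists>v. \<forall>\<^sub>F m in sequentially. f (diagseq m) p = v" for p
  proof -
    from \<open>P (to_nat p) (diagseq \<circ> (+) (Suc (to_nat p)))\<close> obtain v where
      "\<forall>\<^sub>F m in sequentially. f (diagseq (m + Suc (to_nat p))) p = v"
      by (auto simp: P_def add.commute)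
    then have "\<forall>\<^sub>F m in sequentially. f (diagseq m) p = v"
      using eventually_sequentially_seg[where k = "Suc (to_nat p)"
          and P = "\<lambda>m. f (diagseq m) p = v"] by blast
    then show ?thesis by blast
  qed
  define g where "g p = (SOME v. \<forall>\<^sub>F m in sequentially. f (diagseq m) p = v)" for p
  have "\<forall>\<^sub>F m in sequentially. f (diagseq m) p = g p" for p
    unfolding g_def using stable by (rule someI_ex)
  with subseq_diagseq show ?thesis by blast
qed

theorem proposition8:
  fixes G :: "'v two_dim_graph"
  assumes "two_dim_graph G"
    and "sequence_space (A1 G) (matM G) \<noteq> {}"
    and "sequence_space (A2 G) (matN G) \<noteq> {}"
    and "\<forall>i\<in>A1 G. \<forall>j\<in>A1 G. matM G i j \<noteq> 0 \<longrightarrow>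
           (\<forall>i1\<in>A2 G. E_pair G i i1 \<longrightarrow>
             (\<exists>j1\<in>A2 G. E_pair G j j1 \<and> matN G i1 j1 \<noteq> 0))"
  shows "shift_space G \<noteq> {}"
proof -
  obtain t where t: "t \<in> sequence_space (A1 G) (matM G)"
    using assms(2) by blast
  have "staircase G (\<lambda>n. t (int n))"
    unfolding staircase_def
  proof (intro allI conjI)
    fix n
    show "t (int n) \<in> A1 G"
      using t by (auto simp: sequence_space_def)
    have "matM G (t (int n)) (t (int n + 1)) = 1"
      using t by (simp add: sequence_space_def)
    then show "matM G (t (int n)) (t (int (Suc n))) \<noteq> 0"
      by (simp add: add.commute)
  qed
  from octant_filling[OF assms(4) this] obtain c where
    c: "\<And>k n. c k n \<in> symbols G"
    and up: "\<And>k n. adj (ver G) (c k n) (c (Suc k) n) = 1"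
    and right: "\<And>k n. adj (hor G) (c (Suc k) n) (c k (Suc n)) = 1" by blast
  \<comment> \<open>Translate the cell \<open>(m, 3 * m)\<close> to the origin: it lies at distance of order \<open>m\<close> from
      both sides \<open>i = 0\<close> and \<open>i = j\<close> of the octant.  Where \<^const>\<open>nat\<close> truncates, the symbol
      is meaningless, but at any given cell this happens for finitely many \<open>m\<close> only.\<close>
  define f where "f m = (\<lambda>(i, j). c (nat (j - i + 2 * int m)) (nat (i + int m)))" for m
  have f_up: "adj (ver G) (f m (i, j)) (f m (i, j + 1)) = 1"
    and f_right: "adj (hor G) (f m (i, j)) (f m (i + 1, j)) = 1"
    if "\<bar>i\<bar> + \<bar>j\<bar> < int m" for m i j
  proof -
    have "nat (j + 1 - i + 2 * int m) = Suc (nat (j - i + 2 * int m))"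
      using that by linarith
    then show "adj (ver G) (f m (i, j)) (f m (i, j + 1)) = 1"
      using up by (simp add: f_def)
    have "nat (j - i + 2 * int m) = Suc (nat (j - (i + 1) + 2 * int m))"
         "nat (i + 1 + int m) = Suc (nat (i + int m))"
      using that by linarith+
    then show "adj (hor G) (f m (i, j)) (f m (i + 1, j)) = 1"
      using right by (simp add: f_def)
  qed
  have "finite (symbols G)"
    using assms(1) by (simp add: two_dim_graph_def pair_fin_digraph.pair_finite_verts)
  moreover have f_symbols: "f m p \<in> symbols G" for m p
    using c by (cases p) (simp add: f_def)
  ultimately obtain r :: "nat \<Rightarrow> nat" and g where r: "strict_mono r"
    and g: "\<And>p. \<forall>\<^sub>F m in sequentially. f (r m) p = g p"
    using pointwise_stabilizing_subsequence[of "symbols G" f] by blast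
  have "g p \<in> symbols G" for p
  proof -
    obtain m where "f (r m) p = g p"
      using eventually_happens[OF g[of p]] by auto
    with f_symbols[of "r m" p] show ?thesis by simp
  qed
  moreover have "adj (hor G) (g (i, j)) (g (i + 1, j)) = 1 \<and>
                 adj (ver G) (g (i, j)) (g (i, j + 1)) = 1" for i j
  proof -
    have "\<forall>\<^sub>F m in sequentially. \<bar>i\<bar> + \<bar>j\<bar> < int (r m)"
    proof (rule eventually_sequentiallyI)
      fix m assume "nat (\<bar>i\<bar> + \<bar>j\<bar>) + 1 \<le> m"
      with seq_suble[OF r, of m] show "\<bar>i\<bar> + \<bar>j\<bar> < int (r m)" by linarith
    qed
    then have "\<forall>\<^sub>F m in sequentially. \<bar>i\<bar> + \<bar>j\<bar> < int (r m) \<and> f (r m) (i, j) = g (i, j) \<and>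
                 f (r m) (i + 1, j) = g (i + 1, j) \<and> f (r m) (i, j + 1) = g (i, j + 1)"
      using g by (intro eventually_conj)
    then obtain m where "\<bar>i\<bar> + \<bar>j\<bar> < int (r m)" "f (r m) (i, j) = g (i, j)"
        "f (r m) (i + 1, j) = g (i + 1, j)" "f (r m) (i, j + 1) = g (i, j + 1)"
      using eventually_happens trivial_limit_sequentially by blast
    with f_up[of i j "r m"] f_right[of i j "r m"] show ?thesis by simp
  qed
  ultimately have "g \<in> shift_space G"
    by (auto simp: shift_space_def)
  then show ?thesis by blast
qed

end
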